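(* For any three elements $x,y,z\in\mathcal R$, we have $(x\oplus y)\oplus z\sim x\oplus(y\oplus z)$.
   Context: $\mathbb N=\{1,2,3,\dots\}$ and $\mathcal Z_{10}=\{0,1,\dots,9\}$. $\mathcal R$ is the set of all formal decimals $x=x_0.x_1x_2x_3\cdots$ with $x_0\in\mathbb Z$ and $x_k\in\mathcal Z_{10}$ for $k\in\mathbb N$; two elements are equal iff all their digits agree. For $k\in\mathbb N$, $[x]_k=\sum_{i=0}^k x_i10^{-i}\in\mathbb Q$. Order on $\mathcal R$: $x\preceq y$ iff $[x]_k\le [y]_k$ for all $k\in\mathbb N$. Every nonempty bounded above (below) subset of $(\mathcal R,\preceq)$ has a supremum (infimum). $x\sim y$ ("no gap") means that there is no $z\in\mathcal R\setminus\{x,y\}$ lying strictly between $x$ and $y$ with respect to $\preceq$; $\sim$ is an equivalence relation. $\mathbb Q$ is regarded as a subset of $\mathcal R$ via long division: $\alpha=q/p$ ($p\in\mathbb N$, $q\in\mathbb Z$) is identified with $\alpha_0.\alpha_1\alpha_2\cdots$, where $\alpha_0=\lfloor q/p\rfloor$, $\beta_0=q-\alpha_0p$, $\alpha_{k+1}=\lfloor 10\beta_k/p\rfloor$, $\beta_{k+1}=10\beta_k-\alpha_{k+1}p$. For a bounded sequence $\{x^{(n)}\}_{n\in\mathbb N}$ in $\mathcal R$: $\overline{\mathrm{LIMIT}}(\{x^{(n)}\})=\inf\{\sup\{x^{(k)}: k\ge n\}: n\in\mathbb N\}$ and $\underline{\mathrm{LIMIT}}(\{x^{(n)}\})=\sup\{\inf\{x^{(k)}: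 k\ge n\}: n\in\mathbb N\}$; if they are equal, the common value is denoted $\mathrm{LIMIT}(\{x^{(n)}\})$. It exists for bounded monotone sequences. Addition: $x\oplus y=\mathrm{LIMIT}(\{[x]_k+[y]_k\}_{k\in\mathbb N})$, the sums $[x]_k+[y]_k$ being taken in $\mathbb Q$. *)

theory Defs
  imports Complex_Main
begin

text \<open>The integer part is \<open>x 0\<close>, possibly negative; no digit sequences are
  identified, so \<open>0.999...\<close> and \<open>1.000...\<close> are distinct elements.\<close>

typedef decimal = "{x :: nat \<Rightarrow> int. \<forall>k\<ge>1. x k \<in> {0..9}}"
  morphisms digit Decimal
  by (rule exI[of _ "\<lambda>_. 0"]) simp

definition trunc :: "decimal \<Rightarrow> nat \<Rightarrow> rat" where
  "trunc x k = (\<Sum>i\<le>k. of_int (digit x i) / 10 ^ i)"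

lemma digit_range: "k \<ge> 1 \<Longrightarrow> 0 \<le> digit x k \<and> digit x k \<le> 9"
  using digit[of x] by auto

lemma decimal_eqI: "(\<And>k. digit x k = digit y k) \<Longrightarrow> x = y"
  using digit_inject[of x y] by (simp add: fun_eq_iff)

text \<open>The integer \<open>10 ^ k * trunc x k\<close>, used only in proofs.\<close>

primrec scaled :: "decimal \<Rightarrow> nat \<Rightarrow> int" where
  "scaled x 0 = digit x 0"
| "scaled x (Suc k) = 10 * scaled x k + digit x (Suc k)"

lemma trunc_scaled: "trunc x k = of_int (scaled x k) / 10 ^ k"
  by (induction k) (simp_all add: trunc_def add_divide_distrib)

lemma trunc_le_iff: "trunc x k \<le> trunc y k \<longleftrightarrow> scaled x k \<le> scaled y k"
  by (simp add: trunc_scaled divide_le_cancel)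

lemma scaled_div: "scaled x k = scaled x (Suc k) div 10"
  using digit_range[of "Suc k" x] by simp

lemma scaled_eqI:
  assumes "\<And>k. scaled x k = scaled y k"
  shows "x = y"
proof (rule decimal_eqI)
  fix k
  show "digit x k = digit y k"
    using assms[of k] assms[of "k - 1"] by (cases k) auto
qed

lemma scaled_ex:
  fixes M :: "nat \<Rightarrow> int"
  assumes "\<And>k. M k = M (Suc k) div 10"
  shows "\<exists>s. \<forall>k. scaled s k = M k"
proof -
  define d where "d k = (case k of 0 \<Rightarrow> M 0 | Suc j \<Rightarrow> M (Suc j) - 10 * M j)" for k
  have "\<forall>k\<ge>1. d k \<in> {0..9}"
  proof (intro allI impI)
    fix k :: nat
    assume "k \<ge> 1"
    then obtain j where k: "k = Suc j" by (cases k) auto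
    show "d k \<in> {0..9}"
      using assms[of j] by (auto simp: d_def k)
  qed
  then have dig: "digit (Decimal d) = d"
    by (intro Decimal_inverse) auto
  have "scaled (Decimal d) k = M k" for k
    by (induction k) (simp_all add: dig, simp_all add: d_def)
  then show ?thesis by blast
qed

instantiation decimal :: linorder
begin

definition less_eq_decimal :: "decimal \<Rightarrow> decimal \<Rightarrow> bool" where
  "x \<le> y \<longleftrightarrow> (\<forall>k\<ge>1. trunc x k \<le> trunc y k)"

definition less_decimal :: "decimal \<Rightarrow> decimal \<Rightarrow> bool" where
  "x < y \<longleftrightarrow> x \<le> y \<and> x \<noteq> y" for x y :: decimal

lemma le_scaled: "x \<le> y \<longleftrightarrow> (\<forall>k. scaled x k \<le> scaled y k)"
proof
  assume "x \<le> y"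
  then have *: "scaled x (Suc k) \<le> scaled y (Suc k)" for k
    by (auto simp: less_eq_decimal_def trunc_le_iff)
  show "\<forall>k. scaled x k \<le> scaled y k"
    using * by (metis scaled_div zdiv_mono1 zero_less_numeral)
qed (simp add: less_eq_decimal_def trunc_le_iff)

lemma scaled_less_mono:
  "scaled x k < scaled y k \<Longrightarrow> scaled x (k + j) < scaled y (k + j)"
proof (induction j)
  case (Suc j)
  then show ?case
    using digit_range[of "Suc (k + j)" x] digit_range[of "Suc (k + j)" y] by simp
qed simp

instance
proof
  fix x y z :: decimal
  show anti: "x \<le> y \<Longrightarrow> y \<le> x \<Longrightarrow> x = y"
    by (rule scaled_eqI) (meson le_scaled order_antisym)
  then show "x < y \<longleftrightarrow> x \<le> y \<and> \<not> y \<le> x"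
    by (auto simp: less_decimal_def le_scaled)
  show "x \<le> x" by (simp add: le_scaled)
  show "x \<le> y \<Longrightarrow> y \<le> z \<Longrightarrow> x \<le> z"
    unfolding le_scaled by (meson order_trans)
  show "x \<le> y \<or> y \<le> x"
  proof (rule ccontr)
    assume "\<not> (x \<le> y \<or> y \<le> x)"
    then obtain i j where "scaled y i < scaled x i" "scaled x j < scaled y j"
      by (auto simp: le_scaled not_le)
    then have "scaled y (i + j) < scaled x (i + j)" "scaled x (j + i) < scaled y (j + i)"
      by (blast intro: scaled_less_mono)+
    then show False by (simp add: add.commute)
  qed
qed

end

instantiation decimal :: distrib_lattice
begin

definition inf_decimal :: "decimal \<Rightarrow> decimal \<Rightarrow> decimal" where
  "inf x y = min x y" for x y :: decimal

definition sup_decimal :: "decimal \<Rightarrow> decimal \<Rightarrow> decimal" where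
  "sup x y = max x y" for x y :: decimal

instance
  by standard (auto simp: inf_decimal_def sup_decimal_def max_min_distrib2)

end

lemma decimal_lub_ex:
  fixes A :: "decimal set"
  assumes "A \<noteq> {}" and bdd: "bdd_above A"
  shows "\<exists>s. (\<forall>x\<in>A. x \<le> s) \<and> (\<forall>u. (\<forall>x\<in>A. x \<le> u) \<longrightarrow> s \<le> u)"
proof -
  define M where "M k = Sup ((\<lambda>x. scaled x k) ` A)" for k
  obtain b where b: "\<forall>x\<in>A. x \<le> b" using bdd by (auto simp: bdd_above_def)
  have bA: "bdd_above ((\<lambda>x. scaled x k) ` A)" for k
    using b by (auto simp: le_scaled intro!: bdd_aboveI2[of _ _ "scaled b k"])
  have up: "scaled x k \<le> M k" if "x \<in> A" for x k
    unfolding M_def using bA that by (auto intro: cSUP_upper)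
  have att: "\<exists>x\<in>A. scaled x k = M k" for k
  proof (rule ccontr)
    assume "\<not> ?thesis"
    then have "\<forall>x\<in>A. scaled x k \<le> M k - 1" using up[of _ k] by (metis zle_diff1_eq order_le_less)
    then have "Sup ((\<lambda>x. scaled x k) ` A) \<le> M k - 1"
      using \<open>A \<noteq> {}\<close> by (intro cSUP_least) auto
    then show False by (simp add: M_def)
  qed
  have "M k = M (Suc k) div 10" for k
  proof (rule antisym)
    show "M k \<le> M (Suc k) div 10"
      using att[of k] up[of _ "Suc k"] by (metis scaled_div zdiv_mono1 zero_less_numeral)
    show "M (Suc k) div 10 \<le> M k"
      using att[of "Suc k"] up[of _ k] by (metis scaled_div)
  qed
  then obtain s where s: "\<forall>k. scaled s k = M k" using scaled_ex by blast
  have "s \<le> u" if "\<forall>x\<in>A. x \<le> u" for u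
    unfolding le_scaled using att s that by (metis le_scaled)
  moreover have "\<forall>x\<in>A. x \<le> s" using up s by (simp add: le_scaled)
  ultimately show ?thesis by blast
qed

instantiation decimal :: conditionally_complete_linorder
begin

definition Sup_decimal :: "decimal set \<Rightarrow> decimal" where
  "Sup A = (THE s. (\<forall>x\<in>A. x \<le> s) \<and> (\<forall>u. (\<forall>x\<in>A. x \<le> u) \<longrightarrow> s \<le> u))" for A :: "decimal set"

definition Inf_decimal :: "decimal set \<Rightarrow> decimal" where
  "Inf A = (THE s. (\<forall>x\<in>A. s \<le> x) \<and> (\<forall>u. (\<forall>x\<in>A. u \<le> x) \<longrightarrow> u \<le> s))" for A :: "decimal set"

instance
proof
  fix x z :: decimal and A :: "decimal set"
  have sup: "(\<forall>x\<in>A. x \<le> Sup A) \<and> (\<forall>u. (\<forall>x\<in>A. x \<le> u) \<longrightarrow> Sup A \<le> u)"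
    if A: "A \<noteq> {}" "bdd_above A"
  proof -
    obtain s where "(\<forall>x\<in>A. x \<le> s) \<and> (\<forall>u. (\<forall>x\<in>A. x \<le> u) \<longrightarrow> s \<le> u)"
      using decimal_lub_ex[OF A] by blast
    then show ?thesis
      unfolding Sup_decimal_def by (rule theI) (meson order_antisym \<open>_ \<and> _\<close>)
  qed
  have inf: "(\<forall>x\<in>A. Inf A \<le> x) \<and> (\<forall>u. (\<forall>x\<in>A. u \<le> x) \<longrightarrow> u \<le> Inf A)"
    if "A \<noteq> {}" "bdd_below A"
  proof -
    let ?L = "{u. \<forall>x\<in>A. u \<le> x}"
    have "?L \<noteq> {}" "bdd_above ?L" using that by (auto simp: bdd_below_def bdd_above_def)
    then obtain s where s: "\<forall>x\<in>?L. x \<le> s" "\<And>u. \<forall>x\<in>?L. x \<le> u \<Longrightarrow> s \<le> u"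
      using decimal_lub_ex[of ?L] by blast
    then have "(\<forall>x\<in>A. s \<le> x) \<and> (\<forall>u. (\<forall>x\<in>A. u \<le> x) \<longrightarrow> u \<le> s)" by blast
    then show ?thesis
      unfolding Inf_decimal_def by (rule theI) (meson order_antisym \<open>_ \<and> _\<close>)
  qed
  show "x \<in> A \<Longrightarrow> bdd_below A \<Longrightarrow> Inf A \<le> x" using inf by blast
  show "A \<noteq> {} \<Longrightarrow> (\<And>x. x \<in> A \<Longrightarrow> z \<le> x) \<Longrightarrow> z \<le> Inf A"
    using inf by (meson bdd_belowI)
  show "x \<in> A \<Longrightarrow> bdd_above A \<Longrightarrow> x \<le> Sup A" using sup by blast
  show "A \<noteq> {} \<Longrightarrow> (\<And>x. x \<in> A \<Longrightarrow> x \<le> z) \<Longrightarrow> Sup A \<le> z"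
    using sup by (meson bdd_aboveI)
qed

end

definition no_gap :: "decimal \<Rightarrow> decimal \<Rightarrow> bool"  (infix "\<sim>" 50) where
  "x \<sim> y \<longleftrightarrow> \<not> (\<exists>z. z \<notin> {x, y} \<and> (x < z \<and> z < y \<or> y < z \<and> z < x))"

fun rem_seq :: "int \<Rightarrow> int \<Rightarrow> nat \<Rightarrow> int" where
  "rem_seq q p 0 = q - \<lfloor>of_int q / of_int p :: rat\<rfloor> * p"
| "rem_seq q p (Suc k) =
     10 * rem_seq q p k - \<lfloor>of_int (10 * rem_seq q p k) / of_int p :: rat\<rfloor> * p"

fun quot_seq :: "int \<Rightarrow> int \<Rightarrow> nat \<Rightarrow> int" where
  "quot_seq q p 0 = \<lfloor>of_int q / of_int p :: rat\<rfloor>"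
| "quot_seq q p (Suc k) = \<lfloor>of_int (10 * rem_seq q p k) / of_int p :: rat\<rfloor>"

definition long_division :: "int \<Rightarrow> int \<Rightarrow> decimal" where
  "long_division q p = Decimal (quot_seq q p)"

text \<open>The rational is written in lowest terms here; by \<open>decimal_of_rat_divide\<close>
  below any fraction with positive denominator yields the same decimal.\<close>

definition decimal_of_rat :: "rat \<Rightarrow> decimal" where
  "decimal_of_rat r = (case quotient_of r of (q, p) \<Rightarrow> long_division q p)"

lemma floor_rat_div: "\<lfloor>of_int a / of_int b :: rat\<rfloor> = a div b"
  by (rule floor_divide_of_int_eq)

lemma rem_seq_bounds: "p > 0 \<Longrightarrow> 0 \<le> rem_seq q p k \<and> rem_seq q p k < p"
  by (cases k) (simp_all only: rem_seq.simps floor_rat_div minus_div_mult_eq_mod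
      pos_mod_bound pos_mod_sign)

lemma digit_long_division:
  assumes "p > 0"
  shows "digit (long_division q p) = quot_seq q p"
  unfolding long_division_def
proof (rule Decimal_inverse, clarify)
  fix k :: nat
  assume "1 \<le> k"
  then obtain j where k: "k = Suc j" by (cases k) auto
  have "0 \<le> 10 * rem_seq q p j" "10 * rem_seq q p j < 10 * p"
    using rem_seq_bounds[OF assms, of q j] by auto
  then have "0 \<le> (10 * rem_seq q p j) div p" "(10 * rem_seq q p j) div p < 10"
    using assms zdiv_mono1[of "10 * rem_seq q p j" "10 * p - 1" p]
      zdiv_mono1[of 0 "10 * rem_seq q p j" p] int_div_pos_eq[of "10 * p - 1" p 9 "p - 1"]
    by simp_all
  then show "quot_seq q p k \<in> {0..9}"
    unfolding k quot_seq.simps floor_rat_div by simp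
qed

lemma long_division_scale:
  assumes "c > 0"
  shows "long_division (c * q) (c * p) = long_division q p"
proof -
  have d: "(c * a) div (c * b) = a div b" for a b
    using assms by simp
  have c10: "10 * (c * a) = c * (10 * a)" for a by simp
  have r: "rem_seq (c * q) (c * p) k = c * rem_seq q p k" for k
    by (induction k)
      (simp_all only: rem_seq.simps floor_rat_div d c10 right_diff_distrib mult.left_commute)
  have "quot_seq (c * q) (c * p) k = quot_seq q p k" for k
    by (cases k) (simp_all only: quot_seq.simps r floor_rat_div d c10)
  then have "quot_seq (c * q) (c * p) = quot_seq q p" ..
  then show ?thesis by (simp add: long_division_def)
qed

lemma decimal_of_rat_divide:
  assumes "p > 0"
  shows "decimal_of_rat (of_int q / of_int p) = long_division q p"
proof -
  obtain a b where ab: "quotient_of (of_int q / of_int p) = (a, b)" by fastforce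
  have b: "b > 0" using quotient_of_denom_pos[OF ab] .
  have "of_int q / of_int p = (of_int a / of_int b :: rat)"
    using quotient_of_div[OF ab] .
  then have "of_int (q * b) = (of_int (a * p) :: rat)"
    using assms b by (simp add: field_simps)
  then have "b * q = p * a" by (simp only: of_int_eq_iff mult.commute)
  then have "long_division q p = long_division a b"
    using long_division_scale[OF b, of q p] long_division_scale[OF assms, of a b]
    by (simp add: mult.commute)
  then show ?thesis by (simp add: decimal_of_rat_def ab)
qed

text \<open>Sequences are indexed by the positive integers; the value at \<open>0\<close> is ignored.\<close>

definition upper_LIMIT :: "(nat \<Rightarrow> decimal) \<Rightarrow> decimal" where
  "upper_LIMIT s = (INF n\<in>{1..}. SUP k\<in>{n..}. s k)"

definition lower_LIMIT :: "(nat \<Rightarrow> decimal) \<Rightarrow> decimal" where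
  "lower_LIMIT s = (SUP n\<in>{1..}. INF k\<in>{n..}. s k)"

definition has_LIMIT :: "(nat \<Rightarrow> decimal) \<Rightarrow> decimal \<Rightarrow> bool" where
  "has_LIMIT s l \<longleftrightarrow> bdd_above (s ` {1..}) \<and> bdd_below (s ` {1..}) \<and>
     upper_LIMIT s = l \<and> lower_LIMIT s = l"

definition LIMIT :: "(nat \<Rightarrow> decimal) \<Rightarrow> decimal" where
  "LIMIT s = (THE l. has_LIMIT s l)"

definition decimal_add :: "decimal \<Rightarrow> decimal \<Rightarrow> decimal"  (infixl "\<oplus>" 65) where
  "x \<oplus> y = LIMIT (\<lambda>k. decimal_of_rat (trunc x k + trunc y k))"

end

theory Submission
  imports Defs
begin

text \<open>Write \<open>S x k\<close> for the integer \<open>10 ^ k * trunc x k\<close>. The integers \<open>S (x \<oplus> y) k\<close> and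
  \<open>S x k + S y k\<close> differ by at most 2, so both bracketings of a triple sum stay within 4 of
  \<open>S x k + S y k + S z k\<close>, for every \<open>k\<close>. On the other hand, if some decimal lies strictly between
  \<open>a\<close> and \<open>b\<close>, then \<open>S b k - S a k \<ge> 2\<close> for some \<open>k\<close>; since \<open>d \<ge> 2\<close> implies
  \<open>10 * d - 9 > d\<close>, the differences then grow without bound.\<close>

text \<open>The invariant of long division: the new digit times \<open>p\<close> plus the new
  remainder is ten times the old remainder.\<close>

lemma scaled_long_division:
  assumes "p > 0"
  shows "p * scaled (long_division q p) k + rem_seq q p k = q * 10 ^ k"
proof (induction k)
  case 0
  show ?case using digit_long_division[OF assms] by (simp add: algebra_simps)
next
  case (Suc k)
  have "p * scaled (long_division q p) (Suc k) + rem_seq q p (Suc k)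
      = 10 * (p * scaled (long_division q p) k + rem_seq q p k)"
    using digit_long_division[OF assms, of q] by (simp add: algebra_simps)
  then show ?case using Suc by simp
qed

text \<open>The remainder in the invariant lies in \<open>{0..<p}\<close>, so it vanishes under
  \<open>div p\<close>.\<close>

lemma scaled_decimal_of_rat: "scaled (decimal_of_rat r) k = \<lfloor>r * 10 ^ k\<rfloor>"
proof -
  obtain q p where qp: "quotient_of r = (q, p)" by fastforce
  have p: "p > 0" using quotient_of_denom_pos[OF qp] .
  have "\<lfloor>r * 10 ^ k\<rfloor> = \<lfloor>of_int (q * 10 ^ k) / of_int p :: rat\<rfloor>"
    using quotient_of_div[OF qp] by simp
  also have "\<dots> = (p * scaled (long_division q p) k + rem_seq q p k) div p"
    by (simp only: floor_rat_div scaled_long_division[OF p])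
  also have "\<dots> = scaled (long_division q p) k"
    using rem_seq_bounds[OF p, of q k] p by simp
  finally show ?thesis by (simp add: decimal_of_rat_def qp)
qed

lemma decimal_of_rat_mono: "r \<le> r' \<Longrightarrow> decimal_of_rat r \<le> decimal_of_rat r'"
  by (auto simp: le_scaled scaled_decimal_of_rat intro!: floor_mono mult_right_mono)

lemma trunc_mono: "mono (trunc x)"
proof (rule incseq_SucI)
  fix k
  show "trunc x k \<le> trunc x (Suc k)"
    using digit_range[of "Suc k" x] by (simp add: trunc_def)
qed

text \<open>Over the integers, \<open>a < b\<close> gives \<open>10 * a + 9 < 10 * b\<close>, so
  appending a digit preserves the strict bound.\<close>

lemma trunc_less: "trunc x (k + j) < trunc x k + 1 / 10 ^ k"
proof -
  have "scaled x (k + j) < (scaled x k + 1) * 10 ^ j"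
  proof (induction j)
    case (Suc j)
    then show ?case using digit_range[of "Suc (k + j)" x] by simp
  qed simp
  then have "(of_int (scaled x (k + j)) :: rat) < of_int ((scaled x k + 1) * 10 ^ j)"
    by (simp only: of_int_less_iff)
  then show ?thesis by (simp add: trunc_scaled field_simps power_add)
qed

text \<open>All tails share one supremum, and the infimum of a tail is its first term. By
  monotonicity, including index 0 does not change the supremum.\<close>

lemma has_LIMIT_mono:
  fixes s :: "nat \<Rightarrow> decimal"
  assumes "mono s" and bdd: "bdd_above (range s)"
  shows "has_LIMIT s (SUP k. s k)"
proof -
  have bdd': "bdd_above (s ` A)" for A
    using bdd by (rule bdd_above_mono) auto
  have sup: "(SUP k\<in>{n..}. s k) = (SUP k. s k)" for n
  proof (rule antisym)
    show "(SUP k\<in>{n..}. s k) \<le> (SUP k. s k)"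
      using bdd by (intro cSUP_subset_mono) auto
    have "s k \<le> (SUP k\<in>{n..}. s k)" for k
      using monoD[OF \<open>mono s\<close>, of k "max n k"] bdd'
      by (intro cSUP_upper2[of _ _ "max n k"]) auto
    then show "(SUP k. s k) \<le> (SUP k\<in>{n..}. s k)" by (intro cSUP_least) auto
  qed
  have inf: "(INF k\<in>{n..}. s k) = s n" for n
    using monoD[OF \<open>mono s\<close>] by (intro cInf_eq_minimum) auto
  have "bdd_below (s ` {1..})"
    using monoD[OF \<open>mono s\<close>] by (intro bdd_belowI2[of _ "s 1"]) auto
  then show ?thesis
    using bdd' sup[of 1] by (simp add: has_LIMIT_def upper_LIMIT_def lower_LIMIT_def sup inf)
qed

lemma LIMIT_mono:
  assumes "mono s" "bdd_above (range s)"
  shows "LIMIT s = (SUP k. s k)"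
  using has_LIMIT_mono[OF assms] unfolding LIMIT_def
  by (intro the_equality) (auto simp: has_LIMIT_def)

lemma scaled_add_bounds:
  "scaled x k + scaled y k \<le> scaled (x \<oplus> y) k"
  "scaled (x \<oplus> y) k \<le> scaled x k + scaled y k + 2"
proof -
  define s where "s n = decimal_of_rat (trunc x n + trunc y n)" for n
  have "mono s"
    unfolding s_def by (intro monoI decimal_of_rat_mono add_mono monoD[OF trunc_mono])
  \<comment> \<open>Each summand gains less than \<open>1 / 10 ^ k\<close> beyond place
    \<open>k\<close>, whence the 2.\<close>
  define u where "u = decimal_of_rat (trunc x k + trunc y k + 2 / 10 ^ k)"
  have le_u: "s n \<le> u" for n
  proof -
    \<comment> \<open>The shift to \<open>k + n\<close> covers indices below \<open>k\<close>, where
      \<open>trunc_less\<close> does not apply directly.\<close>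
    have "s n \<le> s (k + n)" using \<open>mono s\<close> by (simp add: monoD)
    also have "\<dots> \<le> u"
      unfolding s_def u_def using trunc_less[of x k n] trunc_less[of y k n]
      by (intro decimal_of_rat_mono) simp
    finally show ?thesis .
  qed
  then have bdd: "bdd_above (range s)" by (intro bdd_aboveI2)
  have add: "x \<oplus> y = (SUP n. s n)"
    using LIMIT_mono[OF \<open>mono s\<close> bdd] by (simp add: decimal_add_def flip: s_def)
  have scaled: "(trunc x k + trunc y k) * 10 ^ k = of_int (scaled x k + scaled y k)"
    by (simp add: trunc_scaled field_simps)
  have "s k \<le> x \<oplus> y" unfolding add using bdd by (simp add: cSUP_upper)
  moreover have "scaled (s k) k = scaled x k + scaled y k"
    by (simp only: s_def scaled_decimal_of_rat scaled floor_of_int)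
  ultimately show "scaled x k + scaled y k \<le> scaled (x \<oplus> y) k"
    by (metis le_scaled)
  have "x \<oplus> y \<le> u" unfolding add using le_u by (simp add: cSUP_least)
  moreover have "(trunc x k + trunc y k + 2 / 10 ^ k) * 10 ^ k
      = of_int (scaled x k + scaled y k + 2)"
    using scaled by (simp add: distrib_right)
  then have "scaled u k = scaled x k + scaled y k + 2"
    by (simp only: u_def scaled_decimal_of_rat floor_of_int)
  ultimately show "scaled (x \<oplus> y) k \<le> scaled x k + scaled y k + 2"
    by (metis le_scaled)
qed

lemma scaled_diff_unbounded:
  assumes "a < c" "c < b"
  shows "\<exists>k. scaled b k - scaled a k > C"
proof -
  obtain i j where "scaled a i < scaled c i" "scaled c j < scaled b j"
    using assms by (meson le_scaled not_le)
  \<comment> \<open>The two strict inequalities may first appear at different places, but they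
    persist; at a common place they add up to a difference of at least 2.\<close>
  then have "scaled a (i + j) < scaled c (i + j)" "scaled c (i + j) < scaled b (i + j)"
    using scaled_less_mono[of a i c j] scaled_less_mono[of c j b i] by (simp_all add: add.commute)
  then have "scaled b (i + j + n) - scaled a (i + j + n) \<ge> 2 + int n" for n
  proof (induction n)
    case (Suc n)
    then show ?case
      using digit_range[of "Suc (i + j + n)" a] digit_range[of "Suc (i + j + n)" b] by simp
  qed simp
  from this[of "nat C"] show ?thesis by (intro exI[of _ "i + j + nat C"]) linarith
qed

lemma no_gapI:
  assumes "\<And>k. \<bar>scaled a k - scaled b k\<bar> \<le> C"
  shows "a \<sim> b"
proof -
  have "scaled b k - scaled a k \<le> C" "scaled a k - scaled b k \<le> C" for k
    using assms[of k] by linarith+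
  then show ?thesis
    unfolding no_gap_def by (meson not_le scaled_diff_unbounded)
qed

theorem theorem3p10:
  fixes x y z :: decimal
  shows "(x \<oplus> y) \<oplus> z \<sim> x \<oplus> (y \<oplus> z)"
proof (rule no_gapI)
  fix k
  \<comment> \<open>The errors are never negative, so both values lie between the sum of the three
    scaled values and that sum plus 4.\<close>
  show "\<bar>scaled ((x \<oplus> y) \<oplus> z) k - scaled (x \<oplus> (y \<oplus> z)) k\<bar> \<le> 4"
    using scaled_add_bounds[where x = x and y = y and k = k]
      scaled_add_bounds[where x = "x \<oplus> y" and y = z and k = k]
      scaled_add_bounds[where x = y and y = z and k = k]
      scaled_add_bounds[where x = x and y = "y \<oplus> z" and k = k]
    by linarith
qed

end
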